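(* Let $\lambda>1$. Then there exists a unique value $0<s^*:=s^*(\lambda)<\sqrt{\lambda}-1$ given by \[ s^*(\lambda):=\left(\frac{\ell}{2}-\frac{4\lambda^2+8\lambda-2}{\ell}+\lambda+1\right)\frac{\lambda-1}{3\lambda}, \] where \[ \ell=\sqrt[3]{12\sqrt{3}\,\sqrt{\frac{3\lambda^3+4\lambda^2+20\lambda-4}{\lambda}}\;\lambda^2-28\lambda^3+24\lambda^2-48\lambda+8}, \] such that for all $s\in(0,s^* )$, $\lambda$ is an $s$-deformed Laplacian limit point. Moreover, the correspondence $\lambda\mapsto s^*(\lambda)$ (on $(1,+\infty)$) is increasing, $\lim_{\lambda\to1}s^*(\lambda)=0$ and $\lim_{\lambda\to\infty}s^*(\lambda)=1$. Consequently, for any fixed value $\lambda_0>1$ and for any $s\in(0,s^*(\lambda_0))$ the interval $[\lambda_0,+\infty)$ is entirely formed by $s$-deformed Laplacian limit points.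
   Context: For a finite simple undirected graph $G$ with adjacency matrix $A$ and diagonal degree matrix $D$, and $s\in\mathbb{R}$, the deformed Laplacian matrix of $G$ is $M_G(s)=I-sA+s^2(D-I)$. It is real symmetric; $\rho(M_G(s))$ denotes its spectral radius. A number $\lambda\in\mathbb{R}$ is an $s$-deformed Laplacian limit point (for a fixed $s\in\mathbb{R}$) if there exists a sequence of graphs $(G_n)_{n\in\mathbb{N}}$ such that $\rho(M_{G_i}(s))\neq\rho(M_{G_j}(s))$ for $i\neq j$ and $\lim_{n\to\infty}\rho(M_{G_n}(s))=\lambda$. Cube and square roots are the real ones. The word "unique" refers to the value given by the displayed formula, not to uniqueness among all numbers $s^*$ having the stated limit point property. *)

theory Defs
  imports Complex_Main "Jordan_Normal_Form.Spectral_Radius"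
begin

text \<open>A finite simple undirected graph, taken up to isomorphism, is a pair \<open>(n, E)\<close>: its vertices
  are \<open>0, \<dots>, n - 1\<close> and its edges are unordered pairs of distinct vertices. The graph without
  vertices is excluded, because its matrix has no eigenvalues.\<close>

type_synonym graph = "nat \<times> nat set set"

definition simple_graph :: "graph \<Rightarrow> bool" where
  "simple_graph G \<longleftrightarrow> fst G > 0 \<and> (\<forall>e\<in>snd G. e \<subseteq> {..<fst G} \<and> card e = 2)"

definition vertex_degree :: "graph \<Rightarrow> nat \<Rightarrow> nat" where
  "vertex_degree G i = card {e \<in> snd G. i \<in> e}"

definition adjacency_matrix :: "graph \<Rightarrow> real mat" where
  "adjacency_matrix G = mat (fst G) (fst G) (\<lambda>(i, j). if {i, j} \<in> snd G then 1 else 0)"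

definition degree_matrix :: "graph \<Rightarrow> real mat" where
  "degree_matrix G = mat_diag (fst G) (\<lambda>i. real (vertex_degree G i))"

definition deformed_laplacian :: "graph \<Rightarrow> real \<Rightarrow> real mat" where
  "deformed_laplacian G s =
     1\<^sub>m (fst G) - s \<cdot>\<^sub>m adjacency_matrix G + s\<^sup>2 \<cdot>\<^sub>m (degree_matrix G - 1\<^sub>m (fst G))"

definition deformed_laplacian_radius :: "graph \<Rightarrow> real \<Rightarrow> real" where
  "deformed_laplacian_radius G s =
     spectral_radius (map_mat complex_of_real (deformed_laplacian G s))"

definition deformed_laplacian_limit_point :: "real \<Rightarrow> real \<Rightarrow> bool" where
  "deformed_laplacian_limit_point s x \<longleftrightarrow>
     (\<exists>G :: nat \<Rightarrow> graph.
        (\<forall>k. simple_graph (G k)) \<and>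
        (\<forall>i j. i \<noteq> j \<longrightarrow> deformed_laplacian_radius (G i) s \<noteq> deformed_laplacian_radius (G j) s) \<and>
        (\<lambda>k. deformed_laplacian_radius (G k) s) \<longlonglongrightarrow> x)"

definition ell :: "real \<Rightarrow> real" where
  "ell x = root 3 (12 * sqrt 3 * sqrt ((3 * x ^ 3 + 4 * x\<^sup>2 + 20 * x - 4) / x) * x\<^sup>2
                     - 28 * x ^ 3 + 24 * x\<^sup>2 - 48 * x + 8)"

definition s_star :: "real \<Rightarrow> real" where
  "s_star x = (ell x / 2 - (4 * x\<^sup>2 + 8 * x - 2) / ell x + x + 1) * ((x - 1) / (3 * x))"

end

theory Submission
  imports Defs
begin

text \<open>
  The limit points are realised by caterpillars, that is, paths with pendant leaves, in the manner
  of Shearer's theorem on adjacency limit points. Trees are bipartite, so for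
  \<open>0 < s \<le> 1\<close> their deformed Laplacian is conjugate, by signs, to a nonnegative
  matrix, and a positive eigenvector of that matrix belongs to the spectral radius
  (\<open>deformed_laplacian_radius_eqI\<close>). In the eigenvector equation for the value \<open>\<mu>\<close>
  each leaf is eliminated and costs its spine vertex \<open>d = s\<^sup>2 * \<mu> / (\<mu> - 1)\<close>.
  With \<open>b i = s * w (Suc i) / w i\<close> for the weights \<open>w i\<close> along the spine and \<open>r i\<close> leaves
  at vertex \<open>i\<close>, the equation becomes
  \<open>b (Suc i) = \<mu> - 1 - s\<^sup>2 - r (Suc i) * d - s\<^sup>2 / b i\<close>.

  Take \<open>\<mu> = x\<close>, the desired limit, and choose the leaf counts one after another, greedily,
  so that every \<open>b i\<close> lies in the interval \<open>{s - d..s}\<close>. As the interval has length \<open>d\<close>,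
  this succeeds as soon as \<open>L = s - d\<close> is positive and no spine vertex needs a negative number of
  leaves: \<open>L + s\<^sup>2 / L \<le> x - 1 - s\<^sup>2\<close>. Since all \<open>b i\<close> are positive, each
  truncated caterpillar has radius below \<open>x\<close>. Since \<open>b i \<le> s\<close>, and the map
  \<open>b \<mapsto> - s\<^sup>2 / b\<close> has slope at least \<open>1\<close> on \<open>{0<..s}\<close>, it does not shrink gaps:
  for \<open>\<mu> < x\<close> the same leaf counts give residuals that fall behind \<open>b i\<close> by at least
  \<open>x - \<mu>\<close> more at every step, hence become nonpositive (\<open>ex_spine_weight_nonpos\<close>), so the
  radii eventually reach \<open>\<mu>\<close>. They therefore increase strictly to \<open>x\<close>
  (\<open>deformed_laplacian_limit_pointI\<close>).

  It remains to see that the condition on \<open>L\<close> says \<open>s \<le> s_star x\<close>. In terms of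
  \<open>y = s / (x - 1)\<close> it reads \<open>x * y * (y\<^sup>2 - y + 1) \<le> (1 - y)\<^sup>2\<close>, and the
  displayed formula for \<open>s_star\<close> is Cardano's solution of the corresponding cubic equation
  (\<open>slope_cubic\<close>). The bound by \<open>sqrt x - 1\<close>, the monotonicity and the limits are read off
  this equation, whose root \<open>y\<close> decreases in \<open>x\<close>.
\<close>

section \<open>Bipartite graphs with a positive eigenvector\<close>

definition neighbours :: "graph \<Rightarrow> nat \<Rightarrow> nat set" where
  "neighbours G i = {j. j < fst G \<and> {i, j} \<in> snd G}"

lemma vertex_degree_eq_card_neighbours:
  assumes "simple_graph G"
  shows "vertex_degree G i = card (neighbours G i)"
proof -
  have "bij_betw (\<lambda>j. {i, j}) (neighbours G i) {e \<in> snd G. i \<in> e}"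
  proof (rule bij_betwI')
    fix e assume "e \<in> {e \<in> snd G. i \<in> e}"
    then have e: "e \<in> snd G" "i \<in> e" by auto
    with assms have "card e = 2" "e \<subseteq> {..<fst G}" by (auto simp: simple_graph_def)
    with e(2) obtain j where "e = {i, j}" by (auto simp: card_2_iff doubleton_eq_iff)
    with e \<open>e \<subseteq> {..<fst G}\<close> show "\<exists>j\<in>neighbours G i. e = {i, j}"
      by (auto simp: neighbours_def)
  qed (auto simp: neighbours_def doubleton_eq_iff)
  then show ?thesis
    by (simp add: vertex_degree_def bij_betw_same_card)
qed

text \<open>Written as a sum over neighbours, a row needs no separate degree term: each edge at \<open>i\<close>
  contributes both its part of the degree and its adjacency entry.\<close>

lemma deformed_laplacian_mult_vec:
  fixes v :: "complex vec"
  assumes G: "simple_graph G" and v: "v \<in> carrier_vec (fst G)" and i: "i < fst G"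
  shows "(map_mat complex_of_real (deformed_laplacian G s) *\<^sub>v v) $ i =
    complex_of_real (1 - s\<^sup>2) * v $ i
    + (\<Sum>j\<in>neighbours G i. complex_of_real (s\<^sup>2) * v $ i - complex_of_real s * v $ j)"
proof -
  let ?n = "fst G"
  let ?M = "map_mat complex_of_real (deformed_laplacian G s)"
  let ?d = "complex_of_real (1 - s\<^sup>2 + s\<^sup>2 * card (neighbours G i))"
  have entry: "?M $$ (i, j) = (if i = j then ?d else 0) - (if j \<in> neighbours G i then complex_of_real s else 0)"
    if "j < ?n" for j
    using that i
    by (auto simp: deformed_laplacian_def adjacency_matrix_def degree_matrix_def mat_diag_def
        neighbours_def vertex_degree_eq_card_neighbours[OF G] algebra_simps)
  have carr: "?M \<in> carrier_mat ?n ?n"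
    by (auto simp: deformed_laplacian_def adjacency_matrix_def degree_matrix_def mat_diag_def)
  have "(?M *\<^sub>v v) $ i = (\<Sum>j<?n. ?M $$ (i, j) * v $ j)"
    using carr v i by (auto simp: scalar_prod_def atLeast0LessThan intro!: sum.cong)
  also have "\<dots> = (\<Sum>j<?n. (if i = j then ?d * v $ j else 0)
      - (if j \<in> neighbours G i then s * v $ j else 0))"
    by (intro sum.cong refl) (auto simp: entry left_diff_distrib)
  also have "\<dots> = ?d * v $ i - (\<Sum>j<?n. if j \<in> neighbours G i then s * v $ j else 0)"
    using i by (simp add: sum_subtractf sum.delta')
  also have "(\<Sum>j<?n. if j \<in> neighbours G i then s * v $ j else 0)
      = (\<Sum>j\<in>neighbours G i. s * v $ j)"
    by (rule sum.mono_neutral_cong_right) (auto simp: neighbours_def)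
  finally show ?thesis
    by (simp add: sum_subtractf algebra_simps)
qed

text \<open>The signs \<open>\<sigma>\<close> conjugate the deformed Laplacian into the matrix of its absolute values, of which
  \<open>x\<close> is a positive eigenvector. Such a vector belongs to the spectral radius: scale the modulus
  of any other eigenvector to lie below \<open>x\<close> and touch it at some vertex; the row of that vertex
  bounds the modulus of its eigenvalue by \<open>\<mu>\<close>. The bound \<open>s \<le> 1\<close> keeps the diagonal
  nonnegative.\<close>

lemma deformed_laplacian_radius_eqI:
  fixes x \<sigma> :: "nat \<Rightarrow> real"
  assumes G: "simple_graph G" and s: "0 \<le> s" "s \<le> 1"
    and pos: "\<And>i. i < fst G \<Longrightarrow> x i > 0"
    and sign: "\<And>i. i < fst G \<Longrightarrow> \<bar>\<sigma> i\<bar> = 1"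
    and bip: "\<And>i j. i < fst G \<Longrightarrow> j \<in> neighbours G i \<Longrightarrow> \<sigma> j = - \<sigma> i"
    and eig: "\<And>i. i < fst G \<Longrightarrow>
      (1 - s\<^sup>2) * x i + (\<Sum>j\<in>neighbours G i. s\<^sup>2 * x i + s * x j) = \<mu> * x i"
  shows "deformed_laplacian_radius G s = \<mu>"
proof -
  let ?n = "fst G"
  let ?M = "map_mat complex_of_real (deformed_laplacian G s)"
  have n: "?n > 0" using G by (simp add: simple_graph_def)
  have s2: "s\<^sup>2 \<le> 1" using s by (simp add: power_le_one)
  have carr: "?M \<in> carrier_mat ?n ?n"
    by (auto simp: deformed_laplacian_def adjacency_matrix_def degree_matrix_def mat_diag_def)
  have nb: "j < ?n" if "j \<in> neighbours G i" for i j
    using that by (simp add: neighbours_def)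
  define u where "u = vec ?n (\<lambda>i. complex_of_real (\<sigma> i * x i))"
  have u: "u \<in> carrier_vec ?n" by (simp add: u_def)
  have "?M *\<^sub>v u = complex_of_real \<mu> \<cdot>\<^sub>v u"
  proof (rule eq_vecI)
    fix i assume "i < dim_vec (complex_of_real \<mu> \<cdot>\<^sub>v u)"
    then have i: "i < ?n" by (simp add: u_def)
    have "(?M *\<^sub>v u) $ i = (1 - s\<^sup>2) * u $ i + (\<Sum>j\<in>neighbours G i. s\<^sup>2 * u $ i - s * u $ j)"
      by (rule deformed_laplacian_mult_vec[OF G u i])
    also have "(\<Sum>j\<in>neighbours G i. s\<^sup>2 * u $ i - s * u $ j)
        = (\<Sum>j\<in>neighbours G i. complex_of_real (\<sigma> i * (s\<^sup>2 * x i + s * x j)))"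
      by (intro sum.cong refl) (auto simp: u_def i nb bip[OF i] algebra_simps)
    also have "(1 - s\<^sup>2) * u $ i + \<dots> =
        complex_of_real (\<sigma> i * ((1 - s\<^sup>2) * x i + (\<Sum>j\<in>neighbours G i. s\<^sup>2 * x i + s * x j)))"
      using i by (simp add: u_def sum_distrib_left algebra_simps)
    also have "\<dots> = complex_of_real (\<sigma> i * (\<mu> * x i))"
      by (simp only: eig[OF i])
    also have "\<dots> = (complex_of_real \<mu> \<cdot>\<^sub>v u) $ i"
      using i by (simp add: u_def)
    finally show "(?M *\<^sub>v u) $ i = (complex_of_real \<mu> \<cdot>\<^sub>v u) $ i" .
  qed (use carr in \<open>auto simp: u_def\<close>)
  moreover have "u \<noteq> 0\<^sub>v ?n"
  proof
    assume "u = 0\<^sub>v ?n"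
    then have "u $ 0 = 0" using n by simp
    then show False using n pos[OF n] sign[OF n] by (auto simp: u_def)
  qed
  ultimately have "eigenvalue ?M (complex_of_real \<mu>)"
    using carr u by (auto simp: eigenvalue_def eigenvector_def)
  then have "cmod (complex_of_real \<mu>) \<in> norm ` spectrum ?M"
    unfolding spectrum_def by (intro imageI CollectI)
  then have ge: "\<mu> \<le> spectral_radius ?M"
    using spectral_radius_mem_max(2)[OF carr n] by fastforce
  from spectral_radius_mem_max(1)[OF carr n] obtain \<nu>
    where \<nu>: "spectral_radius ?M = cmod \<nu>" "eigenvalue ?M \<nu>"
    by (auto simp: spectrum_def)
  from \<nu>(2) carr obtain v where v: "v \<in> carrier_vec ?n" "v \<noteq> 0\<^sub>v ?n" "?M *\<^sub>v v = \<nu> \<cdot>\<^sub>v v"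
    by (auto simp: eigenvalue_def eigenvector_def)
  \<comment> \<open>\<open>C\<close> is the least factor for which \<open>C * x\<close> dominates \<open>\<bar>v\<bar>\<close>; they touch at \<open>i\<close>.\<close>
  define C where "C = Max ((\<lambda>i. cmod (v $ i) / x i) ` {..<?n})"
  have "C \<in> (\<lambda>i. cmod (v $ i) / x i) ` {..<?n}"
    unfolding C_def by (rule Max_in) (use n in auto)
  then obtain i where i: "i < ?n" "C = cmod (v $ i) / x i" by auto
  have bound: "cmod (v $ j) \<le> C * x j" if "j < ?n" for j
  proof -
    have "cmod (v $ j) / x j \<le> C"
      unfolding C_def by (rule Max_ge) (use that in auto)
    then show ?thesis using pos[OF that] by (simp add: field_simps)
  qed
  have vi: "cmod (v $ i) = C * x i" using i pos[OF i(1)] by simp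
  have "C \<noteq> 0"
  proof
    assume "C = 0"
    then have "v = 0\<^sub>v ?n" using bound v(1) by (intro eq_vecI) auto
    then show False using v(2) by simp
  qed
  moreover have "C \<ge> 0" using i pos[OF i(1)] by simp
  ultimately have C: "C > 0" by simp
  have "cmod \<nu> * cmod (v $ i) = cmod ((?M *\<^sub>v v) $ i)"
    using v i by (simp add: norm_mult)
  also have "\<dots> = cmod ((1 - s\<^sup>2) * v $ i + (\<Sum>j\<in>neighbours G i. s\<^sup>2 * v $ i - s * v $ j))"
    by (simp only: deformed_laplacian_mult_vec[OF G v(1) i(1)])
  also have "\<dots> \<le> cmod ((1 - s\<^sup>2) * v $ i) + (\<Sum>j\<in>neighbours G i. cmod (s\<^sup>2 * v $ i - s * v $ j))"
    by (intro norm_triangle_le add_mono norm_sum order_refl)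
  also have "\<dots> \<le> (1 - s\<^sup>2) * (C * x i) + (\<Sum>j\<in>neighbours G i. s\<^sup>2 * (C * x i) + s * (C * x j))"
  proof (intro add_mono sum_mono)
    have "cmod ((1 - s\<^sup>2) * v $ i) = \<bar>1 - s\<^sup>2\<bar> * cmod (v $ i)"
      by (metis norm_mult norm_of_real of_real_1 of_real_diff of_real_power)
    then show "cmod ((1 - s\<^sup>2) * v $ i) \<le> (1 - s\<^sup>2) * (C * x i)"
      using s2 by (simp add: vi)
  next
    fix j assume "j \<in> neighbours G i"
    then have "s * cmod (v $ j) \<le> s * (C * x j)"
      using s nb bound by (intro mult_left_mono) auto
    moreover have "cmod (s\<^sup>2 * v $ i - s * v $ j) \<le> cmod (s\<^sup>2 * v $ i) + cmod (s * v $ j)"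
      by (rule norm_triangle_ineq4)
    ultimately show "cmod (s\<^sup>2 * v $ i - s * v $ j) \<le> s\<^sup>2 * (C * x i) + s * (C * x j)"
      using s by (simp add: norm_mult norm_power vi)
  qed
  also have "\<dots> = C * ((1 - s\<^sup>2) * x i + (\<Sum>j\<in>neighbours G i. s\<^sup>2 * x i + s * x j))"
    by (simp add: sum_distrib_left algebra_simps)
  also have "\<dots> = \<mu> * cmod (v $ i)"
    unfolding eig[OF i(1)] vi by simp
  finally have "cmod \<nu> \<le> \<mu>"
    using C pos[OF i(1)] by (simp add: vi)
  with ge \<nu>(1) show ?thesis
    by (simp add: deformed_laplacian_radius_def)
qed

section \<open>Caterpillars\<close>

text \<open>The spine is the path \<open>0, \<dots>, k - 1\<close>; the leaf \<open>k + v\<close> hangs from the spine vertex \<open>own v\<close>.\<close>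

definition caterpillar :: "nat \<Rightarrow> nat \<Rightarrow> (nat \<Rightarrow> nat) \<Rightarrow> graph" where
  "caterpillar k m own =
    (k + m, {{i, Suc i} | i. Suc i < k} \<union> {{own v, k + v} | v. v < m})"

lemma simple_graph_caterpillar:
  assumes "k > 0" "\<And>v. v < m \<Longrightarrow> own v < k"
  shows "simple_graph (caterpillar k m own)"
proof -
  have "own v \<noteq> k + v" if "v < m" for v using assms(2)[OF that] by simp
  moreover have "own v < k + m" if "v < m" for v using assms(2)[OF that] by simp
  ultimately show ?thesis
    using assms(1) by (auto simp: simple_graph_def caterpillar_def)
qed

lemma neighbours_caterpillar_leaf:
  assumes "\<And>v. v < m \<Longrightarrow> own v < k" "v < m"
  shows "neighbours (caterpillar k m own) (k + v) = {own v}"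
  using assms(2) assms(1)[of v] assms(1)
  by (fastforce simp: neighbours_def caterpillar_def doubleton_eq_iff)

lemma neighbours_caterpillar_spine:
  assumes "\<And>v. v < m \<Longrightarrow> own v < k" "i < k"
  shows "neighbours (caterpillar k m own) i =
    {j. j < k \<and> (j = Suc i \<or> i = Suc j)} \<union> (+) k ` {v. v < m \<and> own v = i}"
  using assms(2) assms(1)
  by (auto simp: neighbours_def caterpillar_def doubleton_eq_iff dest: assms(1))

text \<open>Any leaf counts on the spine come from an ownership map: number the pairs of a spine vertex and
  a leaf at it.\<close>

lemma ex_leaf_assignment:
  fixes r :: "nat \<Rightarrow> nat"
  shows "\<exists>(m::nat) own. (\<forall>v<m. own v < k) \<and> (\<forall>i<k. card {v. v < m \<and> own v = i} = r i)"
proof -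
  let ?S = "SIGMA i:{..<k}. {..<r i}"
  have "finite ?S" by auto
  from ex_bij_betw_nat_finite[OF this] obtain h where "bij_betw h {0..<card ?S} ?S" ..
  then obtain N where h: "bij_betw h {0..<N} ?S" by (rule that)
  have mem: "h v \<in> ?S" if "v < N" for v
    using bij_betwE[OF h] that by simp
  have "card {v. v < N \<and> fst (h v) = i} = r i" if "i < k" for i
  proof -
    have img: "h ` {v. v < N \<and> fst (h v) = i} = {i} \<times> {..<r i}"
    proof (intro equalityI subsetI)
      fix p assume p: "p \<in> {i} \<times> {..<r i}"
      then have "p \<in> ?S" using that by auto
      then have "p \<in> h ` {0..<N}" using h by (simp only: bij_betw_def)
      then obtain v where v: "v \<in> {0..<N}" "h v = p" by blast
      have "fst p = i" using p by auto
      then have "v \<in> {v. v < N \<and> fst (h v) = i}" using v by simp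
      then show "p \<in> h ` {v. v < N \<and> fst (h v) = i}" using v(2) by blast
    next
      fix p assume "p \<in> h ` {v. v < N \<and> fst (h v) = i}"
      then obtain v where v: "v < N" "fst (h v) = i" "p = h v" by blast
      have "snd p < r (fst p)" using mem[OF v(1)] unfolding v(3) by auto
      then show "p \<in> {i} \<times> {..<r i}" using v(2,3) by (simp add: mem_Times_iff)
    qed
    have "inj_on h {v. v < N \<and> fst (h v) = i}"
      by (rule inj_on_subset[OF bij_betw_imp_inj_on[OF h]]) auto
    then have "card (h ` {v. v < N \<and> fst (h v) = i}) = card {v. v < N \<and> fst (h v) = i}"
      by (rule card_image)
    then show ?thesis unfolding img by simp
  qed
  moreover have "fst (h v) < k" if "v < N" for v
    using mem[OF that] by auto
  ultimately show ?thesis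
    by (intro exI[where x = N] exI[where x = "\<lambda>v. fst (h v)"]) simp
qed

text \<open>The eigenvector equation at a leaf gives it the weight \<open>s / (\<mu> - 1)\<close> times that of its owner.
  Substituted into the row of the owner, each leaf, together with the degree it adds, contributes
  this multiple of the owner's weight.\<close>

definition leaf_load :: "real \<Rightarrow> real \<Rightarrow> real" where
  "leaf_load s \<mu> = s\<^sup>2 * \<mu> / (\<mu> - 1)"

text \<open>These are the entries on the spine of an eigenvector for the value \<open>\<mu>\<close>, after elimination of
  the leaves, normalised at the first vertex. The first vertex has one neighbour on the spine, the
  later ones have two, which accounts for the missing \<open>s\<^sup>2\<close> in the second equation.\<close>

fun spine_weight :: "(nat \<Rightarrow> nat) \<Rightarrow> real \<Rightarrow> real \<Rightarrow> nat \<Rightarrow> real" where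
  "spine_weight r s \<mu> 0 = 1"
| "spine_weight r s \<mu> (Suc 0) = (\<mu> - 1 - r 0 * leaf_load s \<mu>) / s"
| "spine_weight r s \<mu> (Suc (Suc i)) =
    (\<mu> - 1 - s\<^sup>2 - r (Suc i) * leaf_load s \<mu>) / s * spine_weight r s \<mu> (Suc i)
    - spine_weight r s \<mu> i"

text \<open>The last spine vertex \<open>k\<close> lacks a successor, and with it \<open>s\<^sup>2\<close> in its degree term. Its row is
  the general one with the fictitious next weight \<open>w (Suc k) = - s * w k\<close>: the two contributions
  \<open>s\<^sup>2 * w k + s * w (Suc k)\<close> of the missing edge then cancel.\<close>

lemma ex_caterpillar_with_radius:
  fixes r :: "nat \<Rightarrow> nat"
  assumes s: "0 < s" "s \<le> 1" and \<mu>: "1 < \<mu>" and k: "k > 0"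
    and pos: "\<And>i. i \<le> k \<Longrightarrow> spine_weight r s \<mu> i > 0"
    and fin: "spine_weight r s \<mu> (Suc k) = - s * spine_weight r s \<mu> k"
  shows "\<exists>G. simple_graph G \<and> deformed_laplacian_radius G s = \<mu>"
proof -
  let ?w = "spine_weight r s \<mu>" and ?K = "Suc k"
  obtain m and own :: "nat \<Rightarrow> nat" where own: "\<And>v. v < m \<Longrightarrow> own v < ?K"
    and card: "\<And>i. i < ?K \<Longrightarrow> card {v. v < m \<and> own v = i} = r i"
    using ex_leaf_assignment[of ?K r] by blast
  define G where "G = caterpillar ?K m own"
  define x where "x i = (if i < ?K then ?w i else s / (\<mu> - 1) * ?w (own (i - ?K)))" for i
  define \<sigma> :: "nat \<Rightarrow> real" where
    "\<sigma> i = (if i < ?K then (-1) ^ i else - ((-1) ^ own (i - ?K)))" for i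
  have n: "fst G = ?K + m" by (simp add: G_def caterpillar_def)
  have G: "simple_graph G" unfolding G_def using own by (intro simple_graph_caterpillar) auto
  have leaf: "neighbours G (?K + v) = {own v}" if "v < m" for v
    unfolding G_def using own that by (intro neighbours_caterpillar_leaf)
  have spine: "neighbours G i =
      {j. j < ?K \<and> (j = Suc i \<or> i = Suc j)} \<union> (+) ?K ` {v. v < m \<and> own v = i}"
    if "i < ?K" for i
    unfolding G_def using own that by (intro neighbours_caterpillar_spine)
  have cases: "thesis" if "i < fst G" "i < ?K \<Longrightarrow> thesis" "\<And>v. i = ?K + v \<Longrightarrow> v < m \<Longrightarrow> thesis"
    for i thesis
    using that n by (metis add_less_cancel_left le_add_diff_inverse linorder_not_less)
  have "deformed_laplacian_radius G s = \<mu>"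
  proof (rule deformed_laplacian_radius_eqI[OF G, where x = x and \<sigma> = \<sigma>])
    fix i assume i: "i < fst G"
    show "x i > 0"
      by (rule cases[OF i]) (use pos own s \<mu> in \<open>auto simp: x_def less_Suc_eq_le\<close>)
    show "\<bar>\<sigma> i\<bar> = 1" by (simp add: \<sigma>_def)
    show "\<sigma> j = - \<sigma> i" if "j \<in> neighbours G i" for j
    proof (rule cases[OF i])
      fix v assume v: "i = ?K + v" "v < m"
      then have "j = own v" using that leaf[OF v(2)] by simp
      then show ?thesis using own[OF v(2)] by (simp add: \<sigma>_def v)
    next
      assume iK: "i < ?K"
      consider "j < ?K" "j = Suc i \<or> i = Suc j" | v where "j = ?K + v" "own v = i"
        using \<open>j \<in> neighbours G i\<close> unfolding spine[OF iK] by blast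
      then show ?thesis
      proof cases
        case 1
        then show ?thesis using iK unfolding \<sigma>_def by auto
      next
        case 2
        then show ?thesis using iK by (simp add: \<sigma>_def)
      qed
    qed
    show "(1 - s\<^sup>2) * x i + (\<Sum>j\<in>neighbours G i. s\<^sup>2 * x i + s * x j) = \<mu> * x i"
    proof (rule cases[OF i])
      fix v assume v: "i = ?K + v" "v < m"
      have nbs: "neighbours G i = {own v}" using leaf v by blast
      have xo: "x (own v) = ?w (own v)" using own[OF v(2)] by (simp add: x_def)
      have "x i * (\<mu> - 1) = s * x (own v)" using \<mu> unfolding xo by (simp add: x_def v)
      then show ?thesis unfolding nbs by (simp add: algebra_simps)
    next
      assume iK: "i < ?K"
      let ?P = "{j. j < ?K \<and> (j = Suc i \<or> i = Suc j)}"
      let ?Q = "(+) ?K ` {v. v < m \<and> own v = i}"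
      have "(\<Sum>j\<in>neighbours G i. s\<^sup>2 * x i + s * x j) =
          (\<Sum>j\<in>?P. s\<^sup>2 * x i + s * x j) + (\<Sum>j\<in>?Q. s\<^sup>2 * x i + s * x j)"
        unfolding spine[OF iK] by (rule sum.union_disjoint) auto
      also have "(\<Sum>j\<in>?Q. s\<^sup>2 * x i + s * x j) = (\<Sum>j\<in>?Q. leaf_load s \<mu> * ?w i)"
      proof (intro sum.cong refl)
        fix j assume "j \<in> ?Q"
        then have "x j = s / (\<mu> - 1) * ?w i" by (auto simp: x_def)
        moreover have "x i = ?w i" using iK by (simp add: x_def)
        ultimately show "s\<^sup>2 * x i + s * x j = leaf_load s \<mu> * ?w i"
          using \<mu> by (simp add: leaf_load_def field_simps power2_eq_square)
      qed
      also have "\<dots> = r i * leaf_load s \<mu> * ?w i"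
        by (simp add: card_image card[OF iK] del: add_Suc)
      also have "(\<Sum>j\<in>?P. s\<^sup>2 * x i + s * x j) =
          (\<mu> - 1 + s\<^sup>2 - r i * leaf_load s \<mu>) * ?w i"
      proof (cases i)
        case 0
        then have "?P = {1}" using k by auto
        have "s * ?w 1 = \<mu> - 1 - r 0 * leaf_load s \<mu>" using s by simp
        moreover have "x 1 = ?w 1" "x 0 = 1" using k by (simp_all add: x_def)
        ultimately show ?thesis unfolding \<open>?P = {1}\<close> using 0
          by (simp add: algebra_simps del: One_nat_def)
      next
        case (Suc l)
        have rec: "s * ?w (Suc i) = (\<mu> - 1 - s\<^sup>2 - r i * leaf_load s \<mu>) * ?w i - s * ?w l"
          using s by (simp add: Suc field_simps)
        show ?thesis
        proof (cases "i = k")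
          case True
          have "?P = {l}" using Suc True by auto
          then have "(\<Sum>j\<in>?P. s\<^sup>2 * x i + s * x j) = s\<^sup>2 * ?w i + s * ?w l"
            using Suc True by (simp add: x_def)
          also have "\<dots> = (\<mu> - 1 + s\<^sup>2 - r i * leaf_load s \<mu>) * ?w i"
            using rec fin True by (simp add: algebra_simps power2_eq_square)
          finally show ?thesis .
        next
          case False
          then have "?P = {l, Suc i}" using Suc iK by auto
          then have "(\<Sum>j\<in>?P. s\<^sup>2 * x i + s * x j) = 2 * s\<^sup>2 * ?w i + s * ?w l + s * ?w (Suc i)"
            using Suc False iK by (simp add: x_def)
          also have "\<dots> = (\<mu> - 1 + s\<^sup>2 - r i * leaf_load s \<mu>) * ?w i"
            using rec by (simp add: algebra_simps)
          finally show ?thesis .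
        qed
      qed
      finally show ?thesis using iK by (simp add: x_def algebra_simps)
    qed
  qed (use s in auto)
  with G show ?thesis by blast
qed

section \<open>Greedy leaf counts\<close>

lemma continuous_on_spine_weight:
  assumes "s \<noteq> 0"
  shows "continuous_on {1<..} (\<lambda>\<mu>. spine_weight r s \<mu> i)"
proof -
  have load: "continuous_on {1<..} (leaf_load s)"
    unfolding leaf_load_def by (auto intro!: continuous_intros)
  have "continuous_on {1<..} (\<lambda>\<mu>. spine_weight r s \<mu> i)
      \<and> continuous_on {1<..} (\<lambda>\<mu>. spine_weight r s \<mu> (Suc i))"
    by (induction i) (use assms in \<open>auto intro!: continuous_intros load\<close>)
  then show ?thesis ..
qed

text \<open>As \<open>b \<mapsto> c - s\<^sup>2 / b\<close> is increasing, the second hypothesis on \<open>L\<close> makes every residual before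
  the leaves are subtracted at least \<open>L\<close>, and subtracting the right multiple of \<open>\<delta>\<close> brings it into
  the interval \<open>{L..L + \<delta>}\<close>.\<close>

lemma ex_greedy_leaf_counts:
  fixes \<delta> L :: real
  assumes \<delta>: "\<delta> > 0" and L: "L > 0" "L + s\<^sup>2 / L \<le> c"
  shows "\<exists>r b. b 0 = c + s\<^sup>2 - real (r 0) * \<delta>
    \<and> (\<forall>i. b (Suc i) = c - real (r (Suc i)) * \<delta> - s\<^sup>2 / b i)
    \<and> (\<forall>i. L \<le> b i \<and> b i \<le> L + \<delta>)"
proof -
  have step: "\<exists>r::nat. L \<le> B - r * \<delta> \<and> B - r * \<delta> \<le> L + \<delta>" if "L \<le> B" for B
  proof -
    let ?q = "(B - L) / \<delta>"
    have q: "real (nat \<lfloor>?q\<rfloor>) = of_int \<lfloor>?q\<rfloor>" using that \<delta> by simp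
    have "of_int \<lfloor>?q\<rfloor> \<le> ?q" "?q \<le> of_int \<lfloor>?q\<rfloor> + 1" by linarith+
    then have "real (nat \<lfloor>?q\<rfloor>) * \<delta> \<le> B - L" "B - L \<le> (real (nat \<lfloor>?q\<rfloor>) + 1) * \<delta>"
      using \<delta> unfolding q by (simp_all only: pos_le_divide_eq pos_divide_le_eq)
    then show ?thesis by (intro exI[of _ "nat \<lfloor>?q\<rfloor>"]) (simp add: algebra_simps)
  qed
  let ?P = "\<lambda>(n::nat) p. (n = 0 \<longrightarrow> snd p = c + s\<^sup>2 - real (fst p) * \<delta>)
    \<and> L \<le> snd p \<and> snd p \<le> L + \<delta>"
  let ?Q = "\<lambda>(n::nat) p p'. snd p' = c - real (fst p') * \<delta> - s\<^sup>2 / snd p"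
  have "\<exists>f :: nat \<Rightarrow> nat \<times> real. \<forall>n. ?P n (f n) \<and> ?Q n (f n) (f (Suc n))"
  proof (rule dependent_nat_choice)
    have "L \<le> c + s\<^sup>2" using L by (smt (verit) divide_nonneg_pos zero_le_power2)
    from step[OF this] show "\<exists>p. ?P 0 p" by auto
  next
    fix p :: "nat \<times> real" and n assume p: "?P n p"
    have "s\<^sup>2 / snd p \<le> s\<^sup>2 / L" using p L by (intro divide_left_mono) auto
    then have "L \<le> c - s\<^sup>2 / snd p" using L by linarith
    from step[OF this] obtain r' :: nat where
      "L \<le> c - s\<^sup>2 / snd p - r' * \<delta>" "c - s\<^sup>2 / snd p - r' * \<delta> \<le> L + \<delta>" by blast
    then show "\<exists>p'. ?P (Suc n) p' \<and> ?Q n p p'"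
      by (intro exI[of _ "(r', c - r' * \<delta> - s\<^sup>2 / snd p)"]) (simp add: algebra_simps)
  qed
  then obtain f where "\<And>n. ?P n (f n) \<and> ?Q n (f n) (f (Suc n))" by blast
  then show ?thesis
    by (intro exI[of _ "fst \<circ> f"] exI[of _ "snd \<circ> f"]) auto
qed

lemma spine_weight_pos:
  assumes s: "0 < s"
    and b0: "b 0 = x - 1 - real (r 0) * leaf_load s x"
    and bS: "\<And>i. b (Suc i) = x - 1 - s\<^sup>2 - real (r (Suc i)) * leaf_load s x - s\<^sup>2 / b i"
    and b: "\<And>i. 0 < b i"
  shows "spine_weight r s x i > 0"
proof -
  have "spine_weight r s x i > 0 \<and> spine_weight r s x (Suc i) = b i / s * spine_weight r s x i"
  proof (induction i)
    case 0
    then show ?case by (simp add: b0)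
  next
    case (Suc i)
    then have "spine_weight r s x (Suc i) > 0" using b[of i] s by simp
    moreover have "spine_weight r s x i = s / b i * spine_weight r s x (Suc i)"
      using Suc b[of i] s by simp
    ultimately show ?case
      using s b[of i] by (simp add: bS[of i] field_simps power2_eq_square)
  qed
  then show ?thesis ..
qed

text \<open>If the weights at \<open>\<mu>\<close> stayed positive, their residuals \<open>f i\<close> would be positive and obey the same
  recurrence as \<open>b i\<close>, with a constant smaller by at least \<open>x - \<mu>\<close>. An existing gap \<open>b i - f i\<close> is
  multiplied by \<open>s\<^sup>2 / (f i * b i)\<close>, which is at least \<open>1\<close> because \<open>f i < b i \<le> s\<close>. So the gap
  would grow linearly, while it can never exceed \<open>b i \<le> s\<close>.\<close>

lemma ex_spine_weight_nonpos:
  assumes s: "0 < s" and \<mu>: "1 < \<mu>" "\<mu> < x"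
    and b0: "b 0 = x - 1 - real (r 0) * leaf_load s x"
    and bS: "\<And>i. b (Suc i) = x - 1 - s\<^sup>2 - real (r (Suc i)) * leaf_load s x - s\<^sup>2 / b i"
    and b: "\<And>i. 0 < b i" "\<And>i. b i \<le> s"
  shows "\<exists>i. spine_weight r s \<mu> i \<le> 0"
proof (rule ccontr)
  let ?w = "spine_weight r s \<mu>"
  assume "\<nexists>i. ?w i \<le> 0"
  then have w: "?w i > 0" for i by (simp add: not_le)
  define f where "f i = s * ?w (Suc i) / ?w i" for i
  have f: "f i > 0" for i using w s by (simp add: f_def)
  have f0: "f 0 = \<mu> - 1 - real (r 0) * leaf_load s \<mu>" using s by (simp add: f_def)
  have fS: "f (Suc i) = \<mu> - 1 - s\<^sup>2 - real (r (Suc i)) * leaf_load s \<mu> - s\<^sup>2 / f i" for i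
    using w[of i] w[of "Suc i"] s
    by (simp add: f_def field_simps power2_eq_square)
  have load: "leaf_load s x \<le> leaf_load s \<mu>"
  proof -
    have "leaf_load s z = s\<^sup>2 + s\<^sup>2 / (z - 1)" if "z > 1" for z
      using that by (simp add: leaf_load_def field_simps)
    moreover have "s\<^sup>2 / (x - 1) \<le> s\<^sup>2 / (\<mu> - 1)" using \<mu> by (intro divide_left_mono) auto
    ultimately show ?thesis using \<mu> by simp
  qed
  then have rl: "real k * leaf_load s x \<le> real k * leaf_load s \<mu>" for k :: nat
    by (intro mult_left_mono) auto
  have gap: "b i - f i \<ge> (x - \<mu>) * Suc i" for i
  proof (induction i)
    case 0
    then show ?case using rl[of "r 0"] by (simp add: b0 f0)
  next
    case (Suc i)
    then have d: "b i - f i \<ge> (x - \<mu>) * Suc i" .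
    moreover have "(x - \<mu>) * Suc i > 0" using \<mu> by simp
    ultimately have d0: "b i - f i > 0" by linarith
    have "f i * b i \<le> s * s" using b(2)[of i] d0 f[of i] b(1)[of i] by (intro mult_mono) auto
    then have "(b i - f i) * (f i * b i) \<le> (b i - f i) * s\<^sup>2"
      using d0 by (intro mult_left_mono) (auto simp: power2_eq_square)
    then have "b i - f i \<le> (b i - f i) * s\<^sup>2 / (f i * b i)"
      using f[of i] b(1)[of i] by (simp add: pos_le_divide_eq)
    also have "\<dots> = s\<^sup>2 / f i - s\<^sup>2 / b i"
      using f[of i] b(1)[of i] by (simp add: field_simps)
    finally show ?case
      using d rl[of "r (Suc i)"] unfolding bS fS by (simp add: algebra_simps)
  qed
  obtain N :: nat where "s < real N * (x - \<mu>)"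
    using \<mu> reals_Archimedean3[of "x - \<mu>"] by auto
  moreover have "real N * (x - \<mu>) \<le> (x - \<mu>) * Suc N" using \<mu> by simp
  ultimately have "s < b N - f N" using gap[of N] by linarith
  then show False using b(2)[of N] f[of N] by linarith
qed

text \<open>Lower the value from \<open>x\<close>, where all weights are positive, until one of the weights up to \<open>k\<close> or
  the end condition \<open>w (Suc k) + s * w k\<close> first vanishes. A weight inside the spine cannot be the
  first to vanish, since the recurrence then makes the next one negative; so it is the end
  condition, which makes the stopping value an eigenvalue of the truncated caterpillar.\<close>

lemma ex_truncated_spine_eigenvalue:
  assumes a: "1 < a" "a \<le> x"
    and pos: "\<And>i. spine_weight r s x i > 0" and s: "s > 0"
    and bad: "i0 \<le> k" "spine_weight r s a i0 \<le> 0"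
  shows "\<exists>\<mu>. a \<le> \<mu> \<and> \<mu> < x \<and> (\<forall>i\<le>k. spine_weight r s \<mu> i > 0)
    \<and> spine_weight r s \<mu> (Suc k) = - s * spine_weight r s \<mu> k
    \<and> (\<forall>\<nu>. \<mu> < \<nu> \<and> \<nu> \<le> x \<longrightarrow> (\<forall>i\<le>k. spine_weight r s \<nu> i > 0))"
proof -
  let ?w = "spine_weight r s"
  define h where "h i \<mu> = (if i = Suc k then ?w \<mu> (Suc k) + s * ?w \<mu> k else ?w \<mu> i)" for i \<mu>
  have cont: "continuous_on {a..x} (h i)" for i
  proof (rule continuous_on_subset)
    show "continuous_on {1<..} (h i)"
      unfolding h_def using s
      by (cases "i = Suc k") (auto intro!: continuous_intros continuous_on_spine_weight
        simp del: spine_weight.simps)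
  qed (use a in auto)
  \<comment> \<open>the values at which some weight or the end condition has already failed\<close>
  define B where "B = (\<Union>i\<le>Suc k. {\<mu> \<in> {a..x}. h i \<mu> \<le> 0})"
  have "closed {\<mu> \<in> {a..x}. h i \<mu> \<le> 0}" for i
  proof -
    have "closed (h i -` {..0} \<inter> {a..x})"
      using cont[of i] by (simp add: continuous_on_closed_vimage)
    moreover have "h i -` {..0} \<inter> {a..x} = {\<mu> \<in> {a..x}. h i \<mu> \<le> 0}" by auto
    ultimately show ?thesis by simp
  qed
  then have "closed B" unfolding B_def by auto
  then have "compact ({a..x} \<inter> B)" by (intro compact_Int_closed compact_Icc)
  moreover have "{a..x} \<inter> B = B" by (auto simp: B_def)
  ultimately have "compact B" by simp
  moreover have "a \<in> B" using a bad by (auto simp: B_def h_def intro!: bexI[of _ i0])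
  ultimately obtain \<mu> where \<mu>: "\<mu> \<in> B" "\<And>\<nu>. \<nu> \<in> B \<Longrightarrow> \<nu> \<le> \<mu>"
    using compact_attains_sup[of B] by blast
  have hx: "h i x > 0" for i using pos[of i] pos[of k] pos[of "Suc k"] s
    by (simp add: h_def add_pos_pos del: spine_weight.simps)
  have range: "a \<le> \<mu>" "\<mu> \<le> x" using \<mu>(1) by (auto simp: B_def)
  have "\<mu> \<noteq> x" using \<mu>(1) hx unfolding B_def by (metis (mono_tags, lifting) UN_iff mem_Collect_eq not_le)
  then have lt: "\<mu> < x" using range by simp
  have above: "h i \<nu> > 0" if "\<mu> < \<nu>" "\<nu> \<le> x" "i \<le> Suc k" for i \<nu>
  proof (rule ccontr)
    assume "\<not> ?thesis"
    then have "\<nu> \<in> B" using that range by (auto simp: B_def not_less)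
    then show False using \<mu>(2) that by fastforce
  qed
  have h0: "h i \<mu> \<ge> 0" if "i \<le> Suc k" for i
  proof (rule ccontr)
    assume neg: "\<not> ?thesis"
    have "continuous_on {\<mu>..x} (h i)" using cont by (rule continuous_on_subset) (use range in auto)
    then obtain \<nu> where "\<mu> \<le> \<nu>" "\<nu> \<le> x" "h i \<nu> = 0"
      using IVT'[of "h i" \<mu> 0 x] neg hx[of i] range by auto
    with neg above[of \<nu> i] that show False by (cases "\<nu> = \<mu>") auto
  qed
  have wpos: "i \<le> k \<Longrightarrow> ?w \<mu> i > 0" for i
  proof (induction i)
    case 0
    then show ?case by simp
  next
    case (Suc i)
    then have i: "?w \<mu> i > 0" and ge: "?w \<mu> (Suc i) \<ge> 0"
      using h0[of "Suc i"] by (auto simp: h_def)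
    have "?w \<mu> (Suc i) \<noteq> 0"
    proof
      assume z: "?w \<mu> (Suc i) = 0"
      then have "?w \<mu> (Suc (Suc i)) = - ?w \<mu> i" by simp
      moreover have "h (Suc (Suc i)) \<mu> = ?w \<mu> (Suc (Suc i))"
        using z by (auto simp: h_def simp del: spine_weight.simps)
      ultimately show False
        using h0[of "Suc (Suc i)"] i Suc.prems by (simp del: spine_weight.simps)
    qed
    with ge show ?case by simp
  qed
  obtain i where "i \<le> Suc k" "h i \<mu> \<le> 0" using \<mu>(1) by (auto simp: B_def)
  then have "i = Suc k" using wpos[of i] by (cases "i = Suc k") (auto simp: h_def)
  then have "h (Suc k) \<mu> = 0" using h0[of "Suc k"] \<open>h i \<mu> \<le> 0\<close> by simp
  then have "?w \<mu> (Suc k) = - s * ?w \<mu> k" by (simp add: h_def del: spine_weight.simps)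
  moreover have "?w \<nu> i > 0" if "\<mu> < \<nu>" "\<nu> \<le> x" "i \<le> k" for \<nu> i
    using above[of \<nu> i] that by (simp add: h_def)
  ultimately show ?thesis using range lt wpos by blast
qed

text \<open>The truncated eigenvalues \<open>\<mu> n\<close> increase strictly, because at \<open>\<mu> n\<close> the first weight beyond the
  truncation is negative, which the next truncation does not tolerate. They reach every
  \<open>z < x\<close>, because some weight fails at \<open>z\<close> and this excludes \<open>\<mu> n < z\<close> once the
  truncation includes that weight.\<close>

lemma deformed_laplacian_limit_pointI:
  assumes x: "1 < x" and s: "0 < s" and load: "leaf_load s x < s"
    and L: "(s - leaf_load s x) + s\<^sup>2 / (s - leaf_load s x) \<le> x - 1 - s\<^sup>2"
  shows "deformed_laplacian_limit_point s x"
proof -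
  have "s * (s * x) < s * (x - 1)"
    using load x by (simp add: leaf_load_def power2_eq_square pos_divide_less_eq mult.assoc)
  then have "s * x < x - 1" using s by simp
  then have "s * x < 1 * x" by simp
  then have s1: "s < 1" using x by simp
  have \<delta>: "leaf_load s x > 0" using s x by (simp add: leaf_load_def)
  obtain r b where b0: "b 0 = x - 1 - real (r 0) * leaf_load s x"
    and bS: "\<And>i. b (Suc i) = x - 1 - s\<^sup>2 - real (r (Suc i)) * leaf_load s x - s\<^sup>2 / b i"
    and bL: "\<And>i. s - leaf_load s x \<le> b i" and bs: "\<And>i. b i \<le> s"
    using ex_greedy_leaf_counts[OF \<delta> _ L] load by auto
  have b: "0 < b i" for i using bL[of i] load by linarith
  let ?w = "spine_weight r s"
  have pos: "?w x i > 0" for i by (rule spine_weight_pos[OF s b0 bS b])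
  have bad: "\<exists>i. ?w \<mu> i \<le> 0" if "1 < \<mu>" "\<mu> < x" for \<mu>
    by (rule ex_spine_weight_nonpos[OF s that b0 bS b bs])
  define a where "a = (1 + x) / 2"
  have a: "1 < a" "a < x" using x by (auto simp: a_def)
  obtain i0 where i0: "?w a i0 \<le> 0" using bad[OF a] by blast
  \<comment> \<open>truncations long enough to contain the weight that fails at \<open>a\<close>\<close>
  define m where "m n = Suc (i0 + n)" for n
  have "\<forall>n. \<exists>\<mu>. a \<le> \<mu> \<and> \<mu> < x \<and> (\<forall>i\<le>m n. ?w \<mu> i > 0)
    \<and> ?w \<mu> (Suc (m n)) = - s * ?w \<mu> (m n)
    \<and> (\<forall>\<nu>. \<mu> < \<nu> \<and> \<nu> \<le> x \<longrightarrow> (\<forall>i\<le>m n. ?w \<nu> i > 0))"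
    using ex_truncated_spine_eigenvalue[OF a(1) less_imp_le[OF a(2)] pos s _ i0] 
    by (simp add: m_def del: spine_weight.simps)
  then obtain \<mu> where \<mu>: "\<And>n. a \<le> \<mu> n" "\<And>n. \<mu> n < x"
    and wpos: "\<And>n i. i \<le> m n \<Longrightarrow> ?w (\<mu> n) i > 0"
    and last: "\<And>n. ?w (\<mu> n) (Suc (m n)) = - s * ?w (\<mu> n) (m n)"
    and above: "\<And>n \<nu> i. \<mu> n < \<nu> \<Longrightarrow> \<nu> \<le> x \<Longrightarrow> i \<le> m n \<Longrightarrow> ?w \<nu> i > 0"
    by metis
  have "\<exists>G. simple_graph G \<and> deformed_laplacian_radius G s = \<mu> n" for n
    by (rule ex_caterpillar_with_radius[where r = r and k = "m n"])
      (use s s1 a \<mu>(1)[of n] wpos last in \<open>auto simp: m_def simp del: spine_weight.simps\<close>)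
  then obtain G where G: "\<And>n. simple_graph (G n)" "\<And>n. deformed_laplacian_radius (G n) s = \<mu> n"
    by metis
  have "\<mu> n < \<mu> (Suc n)" for n
  proof -
    have mS: "m (Suc n) = Suc (m n)" by (simp add: m_def)
    have "?w (\<mu> n) (m (Suc n)) < 0"
      using last[of n] wpos[of "m n" n] s unfolding mS by simp
    then have "\<not> \<mu> (Suc n) < \<mu> n" "\<mu> (Suc n) \<noteq> \<mu> n"
      using above[of "Suc n" "\<mu> n" "m (Suc n)"] wpos[of "m (Suc n)" "Suc n"] \<mu>(2)[of n] by auto
    then show ?thesis by simp
  qed
  then have "strict_mono \<mu>" by (simp add: strict_mono_Suc_iff)
  then have dist: "\<mu> i \<noteq> \<mu> j" if "i \<noteq> j" for i j
    using that by (simp add: strict_mono_eq)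
  have "\<mu> \<longlonglongrightarrow> x"
  proof (rule order_tendstoI)
    fix y assume "x < y"
    then show "\<forall>\<^sub>F n in sequentially. \<mu> n < y"
      using \<mu>(2) by (intro always_eventually) (auto intro: less_trans)
  next
    fix y assume y: "y < x"
    define z where "z = (max a y + x) / 2"
    have z: "1 < z" "z < x" "y < z" using a y by (auto simp: z_def)
    obtain i where i: "?w z i \<le> 0" using bad z by blast
    have "y < \<mu> n" if "n \<ge> i" for n
    proof -
      have "\<not> \<mu> n < z" using above[of n z i] i z that by (auto simp: m_def)
      with z show ?thesis by linarith
    qed
    then show "\<forall>\<^sub>F n in sequentially. y < \<mu> n"
      by (auto simp: eventually_sequentially)
  qed
  with G dist show ?thesis
    unfolding deformed_laplacian_limit_point_def by (intro exI[of _ G]) simp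
qed

section \<open>The threshold as the root of a cubic\<close>

text \<open>The hypothesis says that \<open>u ^ 3\<close> is a root of the quadratic resolvent of the depressed cubic
  \<open>t ^ 3 + 3 * p * t + q\<close>.\<close>

lemma cardano_root:
  fixes u p q :: real
  assumes "u \<noteq> 0" "u ^ 6 + q * u ^ 3 = p ^ 3"
  shows "(u - p / u) ^ 3 + 3 * p * (u - p / u) + q = 0"
proof -
  have "((u - p / u) ^ 3 + 3 * p * (u - p / u) + q) * u ^ 3 = u ^ 6 + q * u ^ 3 - p ^ 3"
    using assms(1) by (simp add: field_simps power3_eq_cube power2_eq_square power_def)
  then show ?thesis using assms by simp
qed

text \<open>The number under the cube root is \<open>R + P\<close> with the square root term \<open>R\<close>, and
  \<open>R\<^sup>2 - P\<^sup>2 = 64 * (2 * x\<^sup>2 + 4 * x - 1) ^ 3\<close>. As this is positive, so is \<open>R + P\<close>; and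
  \<open>(R + P) / 8\<close> solves the resolvent, whose roots are \<open>(P + R) / 8\<close> and \<open>(P - R) / 8\<close>.\<close>

lemma ell_quadratic:
  assumes x: "x > 1"
  shows "ell x > 0"
    and "(ell x / 2) ^ 6 + (7 * x ^ 3 - 6 * x\<^sup>2 + 12 * x - 2) * (ell x / 2) ^ 3
      = (2 * x\<^sup>2 + 4 * x - 1) ^ 3"
proof -
  define P where "P = - 28 * x ^ 3 + 24 * x\<^sup>2 - 48 * x + 8"
  define R where "R = 12 * sqrt 3 * sqrt ((3 * x ^ 3 + 4 * x\<^sup>2 + 20 * x - 4) / x) * x\<^sup>2"
  have ell: "ell x = root 3 (R + P)"
    by (simp add: ell_def R_def P_def algebra_simps)
  have c: "3 * x ^ 3 + 4 * x\<^sup>2 + 20 * x - 4 > 0"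
  proof -
    have "3 * x ^ 3 \<ge> 0" "4 * x\<^sup>2 \<ge> 0" using x by auto
    then show ?thesis using x by linarith
  qed
  have "R\<^sup>2 = 432 * ((3 * x ^ 3 + 4 * x\<^sup>2 + 20 * x - 4) / x) * x ^ 4"
    using c x by (simp add: R_def power_mult_distrib)
  then have "R\<^sup>2 = 432 * (3 * x ^ 3 + 4 * x\<^sup>2 + 20 * x - 4) * x ^ 3"
    using x by (simp add: eval_nat_numeral)
  then have RP: "R\<^sup>2 - P\<^sup>2 = 64 * (2 * x\<^sup>2 + 4 * x - 1) ^ 3"
    by (simp add: P_def algebra_simps eval_nat_numeral)
  have p: "2 * x\<^sup>2 + 4 * x - 1 > 0" using x zero_le_power2[of x] by linarith
  then have "P\<^sup>2 < R\<^sup>2" using RP by (smt (verit) zero_less_power)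
  moreover have "R \<ge> 0" using c x by (simp add: R_def)
  ultimately have "\<bar>P\<bar> < R" by (metis abs_of_nonneg power2_abs power2_less_imp_less)
  then have sum: "R + P > 0" by linarith
  then show "ell x > 0" by (simp add: ell)
  have cube: "ell x ^ 3 = R + P" by (simp add: ell odd_real_root_pow)
  have "(ell x / 2) ^ 6 = (ell x ^ 3)\<^sup>2 / 64" by (simp add: power_divide flip: power_mult)
  moreover have "(ell x / 2) ^ 3 = ell x ^ 3 / 8" by (simp add: power_divide)
  moreover have "7 * x ^ 3 - 6 * x\<^sup>2 + 12 * x - 2 = - P / 4" by (simp add: P_def)
  ultimately have "(ell x / 2) ^ 6 + (7 * x ^ 3 - 6 * x\<^sup>2 + 12 * x - 2) * (ell x / 2) ^ 3
      = (R\<^sup>2 - P\<^sup>2) / 64"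
    by (simp only: cube) (simp add: field_simps power2_eq_square)
  with RP show "(ell x / 2) ^ 6 + (7 * x ^ 3 - 6 * x\<^sup>2 + 12 * x - 2) * (ell x / 2) ^ 3
      = (2 * x\<^sup>2 + 4 * x - 1) ^ 3" by simp
qed

text \<open>In this variable the cubic equation of the threshold takes its simplest form.\<close>

definition slope :: "real \<Rightarrow> real" where
  "slope x = s_star x / (x - 1)"

text \<open>The substitution \<open>t = 3 * x * y - (x + 1)\<close> removes the quadratic term of
  \<open>x * y ^ 3 - (x + 1) * y\<^sup>2 + (x + 2) * y - 1\<close> in \<open>y\<close>, and Cardano's formula for the resulting
  equation in \<open>t\<close> is the definition of \<open>s_star\<close>.\<close>

lemma slope_cubic:
  assumes x: "x > 1"
  shows "x * (slope x * ((slope x)\<^sup>2 - slope x + 1)) = (1 - slope x)\<^sup>2"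
proof -
  define u where "u = ell x / 2"
  define p where "p = 2 * x\<^sup>2 + 4 * x - 1"
  define t where "t = u - p / u"
  have u: "u > 0" using ell_quadratic(1)[OF x] by (simp add: u_def)
  have "slope x = (t + x + 1) / (3 * x)"
    using x u by (simp add: slope_def s_star_def t_def p_def u_def field_simps)
  then have t: "t = 3 * x * slope x - (x + 1)" using x by (simp add: field_simps)
  have "t ^ 3 + 3 * p * t + (7 * x ^ 3 - 6 * x\<^sup>2 + 12 * x - 2) = 0"
    unfolding t_def using ell_quadratic(2)[OF x] u
    by (intro cardano_root) (auto simp: u_def p_def)
  moreover have "t ^ 3 + 3 * p * t + (7 * x ^ 3 - 6 * x\<^sup>2 + 12 * x - 2)
      = 27 * x\<^sup>2 * (x * (slope x * ((slope x)\<^sup>2 - slope x + 1)) - (1 - slope x)\<^sup>2)"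
    unfolding t p_def by (simp add: algebra_simps power2_eq_square power3_eq_cube)
  ultimately show ?thesis using x by simp
qed

text \<open>The difference of the two sides is \<open>z - y\<close> times a sum of two positive quadratic polynomials,
  the first of them with the factor \<open>x - 1\<close>.\<close>

lemma cubic_strict_mono:
  fixes x y z :: real
  assumes "x \<ge> 1" "y < z"
  shows "x * (y * (y\<^sup>2 - y + 1)) - (1 - y)\<^sup>2 < x * (z * (z\<^sup>2 - z + 1)) - (1 - z)\<^sup>2"
proof -
  let ?A = "z\<^sup>2 + z * y + y\<^sup>2"
  have A: "?A = (z - y)\<^sup>2 / 4 + 3 / 4 * (z + y)\<^sup>2" by (simp add: field_simps power2_eq_square)
  have "?A - (z + y) + 1 = (z - y)\<^sup>2 / 4 + 3 / 4 * (z + y - 2 / 3)\<^sup>2 + 2 / 3"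
    unfolding A by (simp add: field_simps power2_eq_square)
  then have "?A - (z + y) + 1 \<ge> 0" by simp
  then have "(x - 1) * (?A - (z + y) + 1) \<ge> 0" using assms by simp
  moreover have "?A - 2 * (z + y) + 3 > 0"
  proof -
    have "?A - 2 * (z + y) + 3 = (z - y)\<^sup>2 / 4 + 3 / 4 * (z + y - 4 / 3)\<^sup>2 + 5 / 3"
      unfolding A by (simp add: field_simps power2_eq_square)
    moreover have "(z - y)\<^sup>2 \<ge> 0" "(z + y - 4 / 3)\<^sup>2 \<ge> 0" by auto
    ultimately show ?thesis by linarith
  qed
  ultimately have "(z - y) * ((x - 1) * (?A - (z + y) + 1) + (?A - 2 * (z + y) + 3)) > 0"
    using assms by (intro mult_pos_pos) auto
  also have "(z - y) * ((x - 1) * (?A - (z + y) + 1) + (?A - 2 * (z + y) + 3))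
      = x * (z * (z\<^sup>2 - z + 1)) - (1 - z)\<^sup>2 - (x * (y * (y\<^sup>2 - y + 1)) - (1 - y)\<^sup>2)"
    by (simp add: algebra_simps power2_eq_square)
  finally show ?thesis by simp
qed

lemma quadratic_pos: "(y::real)\<^sup>2 - y + 1 \<ge> 3 / 4"
proof -
  have "y\<^sup>2 - y + 1 = (y - 1 / 2)\<^sup>2 + 3 / 4" by (simp add: field_simps power2_eq_square)
  then show ?thesis by simp
qed

lemma slope_bounds:
  assumes x: "x > 1"
  shows "0 < slope x" "slope x < 1"
proof -
  show "0 < slope x"
    using cubic_strict_mono[of x "slope x" 0] slope_cubic[OF x] x
    by (cases "slope x = 0") (auto simp: not_less intro: ccontr)
  show "slope x < 1"
    using cubic_strict_mono[of x 1 "slope x"] slope_cubic[OF x] x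
    by (cases "slope x = 1") (auto simp: not_less intro: ccontr)
qed

lemma slope_strict_antimono:
  assumes "1 < x" "x < x'"
  shows "slope x' < slope x"
proof -
  let ?y = "slope x"
  have y: "0 < ?y" using slope_bounds assms by simp
  have "x * (?y * (?y\<^sup>2 - ?y + 1)) < x' * (?y * (?y\<^sup>2 - ?y + 1))"
    using assms y quadratic_pos[of ?y] by (intro mult_strict_right_mono mult_pos_pos) auto
  then have "x' * (?y * (?y\<^sup>2 - ?y + 1)) - (1 - ?y)\<^sup>2 > 0"
    using slope_cubic[OF assms(1)] by simp
  then show ?thesis
    using cubic_strict_mono[of x' ?y "slope x'"] slope_cubic[of x'] assms
    by (cases "slope x' = ?y") (auto simp: not_less intro: ccontr)
qed

lemma s_star_eq_slope_mult: "x > 1 \<Longrightarrow> s_star x = slope x * (x - 1)"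
  by (simp add: slope_def)

text \<open>Eliminating \<open>x\<close> by the cubic equation expresses the threshold by the slope alone, as a decreasing
  function on the unit interval with value \<open>1\<close> at \<open>0\<close>.\<close>

lemma s_star_eq_slope:
  assumes x: "x > 1"
  shows "s_star x = 1 - slope x - slope x / ((slope x)\<^sup>2 - slope x + 1)"
proof -
  let ?y = "slope x" and ?q = "(slope x)\<^sup>2 - slope x + 1"
  have q: "?q > 0" using quadratic_pos[of ?y] by linarith
  have "x * ?y * ?q = ?q - ?y" using slope_cubic[OF x] by (simp add: algebra_simps power2_eq_square)
  then have "x * ?y = (?q - ?y) / ?q" using q by (simp only: eq_divide_eq) auto
  also have "\<dots> = 1 - ?y / ?q" using q by (simp only: diff_divide_distrib[of ?q]) simp
  finally show ?thesis using x by (simp add: s_star_eq_slope_mult algebra_simps)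
qed

lemma strict_mono_on_s_star: "strict_mono_on {1<..} s_star"
proof (rule strict_mono_onI)
  fix x x' :: real assume "x \<in> {1<..}" "x' \<in> {1<..}" "x < x'"
  then have x: "1 < x" "1 < x'" by auto
  let ?y = "slope x'" and ?z = "slope x"
  have yz: "?y < ?z" using \<open>x < x'\<close> x by (intro slope_strict_antimono)
  have b: "0 < ?y" "?z < 1" using slope_bounds x by auto
  have "?y * ?z < 1" using b yz mult_strict_mono[of ?y 1 ?z 1] by simp
  then have "?y * ?z * (?z - ?y) < 1 * (?z - ?y)" using yz by (intro mult_strict_right_mono) auto
  then have "?y * (?z\<^sup>2 - ?z + 1) < ?z * (?y\<^sup>2 - ?y + 1)"
    by (simp add: algebra_simps power2_eq_square)
  then have "?y / (?y\<^sup>2 - ?y + 1) < ?z / (?z\<^sup>2 - ?z + 1)"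
    using quadratic_pos[of ?y] quadratic_pos[of ?z] by (simp add: divide_simps mult.commute)
  with yz show "s_star x < s_star x'" using x by (simp add: s_star_eq_slope)
qed

lemma s_star_pos: "x > 1 \<Longrightarrow> s_star x > 0"
  using slope_bounds[of x] by (simp add: s_star_eq_slope_mult)

text \<open>As \<open>y < y\<^sup>2 - y + 1\<close> for \<open>y < 1\<close>, the cubic equation gives
  \<open>x * y\<^sup>2 < (1 - y)\<^sup>2\<close>, so \<open>y * (sqrt x + 1) < 1\<close>.\<close>

lemma s_star_less_sqrt:
  assumes x: "x > 1"
  shows "s_star x < sqrt x - 1"
proof -
  let ?y = "slope x"
  have y: "0 < ?y" "?y < 1" using slope_bounds x by auto
  have "0 < (1 - ?y)\<^sup>2" using y by simp
  then have "?y < ?y\<^sup>2 - ?y + 1" by (simp add: power2_eq_square algebra_simps)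
  then have "x * (?y * ?y) < x * (?y * (?y\<^sup>2 - ?y + 1))" using x y by simp
  then have "x * (?y * ?y) < (1 - ?y)\<^sup>2" by (simp only: slope_cubic[OF x])
  then have "(sqrt x * ?y)\<^sup>2 < (1 - ?y)\<^sup>2"
    using x by (simp add: power_mult_distrib power2_eq_square[of "slope x"])
  then have "sqrt x * ?y < 1 - ?y" by (rule power2_less_imp_less) (use y in simp)
  then have "?y * (sqrt x + 1) < 1" by (simp add: distrib_left mult.commute)
  moreover have "sqrt x - 1 > 0" using x by simp
  ultimately have "(?y * (sqrt x + 1)) * (sqrt x - 1) < 1 * (sqrt x - 1)"
    by (rule mult_strict_right_mono)
  moreover have "(sqrt x + 1) * (sqrt x - 1) = x - 1"
  proof -
    have "(sqrt x + 1) * (sqrt x - 1) = sqrt x * sqrt x - 1"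
      by (rule square_diff_one_factored[symmetric])
    also have "sqrt x * sqrt x = x" using x by simp
    finally show ?thesis .
  qed
  ultimately show ?thesis using x by (simp only: s_star_eq_slope_mult mult.assoc mult_1)
qed

lemma s_star_tendsto_0: "(s_star \<longlongrightarrow> 0) (at_right 1)"
proof (rule tendsto_sandwich)
  have ev: "\<forall>\<^sub>F x::real in at_right 1. x > 1" by (simp add: eventually_at_right_less)
  then show "\<forall>\<^sub>F x in at_right 1. 0 \<le> s_star x"
    by eventually_elim (simp add: s_star_pos less_imp_le)
  show "\<forall>\<^sub>F x in at_right 1. s_star x \<le> x - 1"
    using ev
  proof eventually_elim
    fix x :: real assume "x > 1"
    then show "s_star x \<le> x - 1"
      using slope_bounds[of x] by (simp add: s_star_eq_slope_mult)
  qed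
  have "((\<lambda>x::real. x - 1) \<longlongrightarrow> 1 - 1) (at_right 1)" by (intro tendsto_intros)
  then show "((\<lambda>x::real. x - 1) \<longlongrightarrow> 0) (at_right 1)" by simp
qed simp

lemma slope_le:
  assumes x: "x > 1"
  shows "slope x \<le> 4 / (3 * x)"
proof -
  let ?y = "slope x"
  have y: "0 < ?y" "?y < 1" using slope_bounds x by auto
  have "x * (?y * (3 / 4)) \<le> x * (?y * (?y\<^sup>2 - ?y + 1))"
    using x y quadratic_pos[of ?y] by (intro mult_left_mono) auto
  also have "\<dots> = (1 - ?y)\<^sup>2" by (rule slope_cubic[OF x])
  also have "\<dots> \<le> 1" using y by (intro power_le_one) auto
  finally show ?thesis using x by (simp add: field_simps)
qed

lemma s_star_tendsto_1: "(s_star \<longlongrightarrow> 1) at_top"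
proof (rule tendsto_sandwich)
  have ev: "\<forall>\<^sub>F x::real in at_top. x > 1" by (rule eventually_gt_at_top)
  show "\<forall>\<^sub>F x in at_top. 1 - 28 / 9 * inverse x \<le> s_star x"
    using ev
  proof eventually_elim
    fix x :: real assume x: "x > 1"
    let ?y = "slope x"
    have y: "0 < ?y" using slope_bounds x by auto
    have "?y / (?y\<^sup>2 - ?y + 1) \<le> ?y / (3 / 4)"
      using y quadratic_pos[of ?y] by (intro divide_left_mono) auto
    then have "1 - 7 / 3 * ?y \<le> s_star x" using x by (simp add: s_star_eq_slope)
    moreover have "7 / 3 * ?y \<le> 28 / 9 * inverse x"
      using slope_le[OF x] x by (simp add: field_simps)
    ultimately show "1 - 28 / 9 * inverse x \<le> s_star x" by linarith
  qed
  show "\<forall>\<^sub>F x in at_top. s_star x \<le> 1"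
    using ev
  proof eventually_elim
    fix x :: real assume x: "x > 1"
    have "0 < slope x" "0 < (slope x)\<^sup>2 - slope x + 1"
      using slope_bounds[OF x] quadratic_pos[of "slope x"] by auto
    then have "slope x / ((slope x)\<^sup>2 - slope x + 1) > 0" by (rule divide_pos_pos)
    then show "s_star x \<le> 1" using x \<open>0 < slope x\<close> by (simp add: s_star_eq_slope)
  qed
  have "((\<lambda>x::real. 1 - 28 / 9 * inverse x) \<longlongrightarrow> 1 - 28 / 9 * 0) at_top"
    by (intro tendsto_intros tendsto_inverse_0_at_top filterlim_ident)
  then show "((\<lambda>x::real. 1 - 28 / 9 * inverse x) \<longlongrightarrow> 1) at_top" by simp
qed simp

section \<open>Limit points below the threshold\<close>

text \<open>Below the threshold \<open>y = s / (x - 1)\<close> lies below the root of the cubic. With \<open>L = s * (1 - x * y)\<close>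
  the condition \<open>L\<^sup>2 - (x - 1 - s\<^sup>2) * L + s\<^sup>2 \<le> 0\<close> of the greedy construction is the cubic
  inequality up to the factor \<open>s * (x - 1)\<close>.\<close>

lemma limit_point_below_s_star:
  assumes x: "x > 1" and s: "0 < s" "s < s_star x"
  shows "deformed_laplacian_limit_point s x"
proof -
  define y where "y = s / (x - 1)"
  have sy: "s = y * (x - 1)" using x by (simp add: y_def)
  have y: "0 < y" "y < slope x"
    using s x by (simp_all add: y_def s_star_eq_slope_mult pos_divide_less_eq)
  let ?q = "y\<^sup>2 - y + 1"
  have q: "?q > 0" using quadratic_pos[of y] by linarith
  have cubic: "x * (y * ?q) < (1 - y)\<^sup>2"
    using cubic_strict_mono[of x y "slope x"] slope_cubic[OF x] x y by simp
  also have "(1 - y)\<^sup>2 < 1 * ?q" using y by (simp add: power2_eq_square algebra_simps)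
  finally have xy: "x * y < 1"
    using q by (simp only: mult_less_cancel_right_pos flip: mult.assoc)
  have load: "leaf_load s x = s * (x * y)"
    using x by (simp add: leaf_load_def y_def power2_eq_square)
  define L where "L = s - leaf_load s x"
  have L: "L = s * (1 - x * y)" by (simp add: L_def load algebra_simps)
  have L0: "L > 0" using s xy by (simp add: L)
  have "L\<^sup>2 + s\<^sup>2 - (x - 1 - s\<^sup>2) * L = s * (x - 1) * (x * (y * ?q) - (1 - y)\<^sup>2)"
    unfolding L sy by (simp add: algebra_simps power2_eq_square)
  also have "\<dots> < 0" using s x cubic by (intro mult_pos_neg) auto
  finally have "L + s\<^sup>2 / L \<le> x - 1 - s\<^sup>2"
    using L0 by (simp add: field_simps power2_eq_square)
  then show ?thesis
    using L0 x s unfolding L_def by (intro deformed_laplacian_limit_pointI) auto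
qed

theorem theorem10:
  shows "(\<forall>x::real. x > 1 \<longrightarrow>
            (\<exists>!v. v = s_star x \<and> 0 < v \<and> v < sqrt x - 1 \<and>
                  (\<forall>s. 0 < s \<and> s < v \<longrightarrow> deformed_laplacian_limit_point s x))) \<and>
         strict_mono_on {1<..} s_star \<and>
         (s_star \<longlongrightarrow> 0) (at_right 1) \<and>
         (s_star \<longlongrightarrow> 1) at_top \<and>
         (\<forall>x\<^sub>0 s :: real. x\<^sub>0 > 1 \<and> 0 < s \<and> s < s_star x\<^sub>0 \<longrightarrow>
           (\<forall>x\<in>{x\<^sub>0..}. deformed_laplacian_limit_point s x))"
proof (intro conjI allI impI ballI)
  fix x :: real assume x: "x > 1"
  show "\<exists>!v. v = s_star x \<and> 0 < v \<and> v < sqrt x - 1 \<and>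
      (\<forall>s. 0 < s \<and> s < v \<longrightarrow> deformed_laplacian_limit_point s x)"
    using s_star_pos[OF x] s_star_less_sqrt[OF x] limit_point_below_s_star[OF x] by auto
next
  fix x0 s x :: real
  assume s: "x0 > 1 \<and> 0 < s \<and> s < s_star x0" and x: "x \<in> {x0..}"
  have "s_star x0 \<le> s_star x"
    by (rule strict_mono_on_leD[OF strict_mono_on_s_star]) (use s x in auto)
  then have "1 < x" "0 < s" "s < s_star x" using s x by auto
  then show "deformed_laplacian_limit_point s x" by (rule limit_point_below_s_star)
qed (rule strict_mono_on_s_star s_star_tendsto_0 s_star_tendsto_1)+

end
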